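(* For any $k\ge2$ groups in which all agents have binary utilities, there exists an allocation $(G_1,\dots,G_k)$ such that for every $i$, at least $n_i/k$ agents of $A_i$ find it simultaneously EF1, PROP$(k-1)$ and MMS-fair.
   Context: There is a finite set $G$ of goods and $k$ groups $A_1,\dots,A_k$ with $n_i\ge1$ agents in $A_i$. A binary agent has an additive utility with $u_a(\{g\})\in\{0,1\}$. An allocation is a partition $(G_1,\dots,G_k)$ of $G$; agents of $A_i$ get $u_a(G_i)$. For $a\in A_i$: EF1 means for every $i'$ there is $C\subseteq G_{i'}$, $|C|\le1$, with $u_a(G_i)\ge u_a(G_{i'}\setminus C)$; PROP$(k-1)$ means there is $C\subseteq G\setminus G_i$, $|C|\le k-1$, with $u_a(G_i)\ge\frac1k u_a(G\setminus C)$; MMS-fair means $u_a(G_i)\ge \mathrm{MMS}^k_a(G)$, where $\mathrm{MMS}^k_a(G)$ is the maximum over partitions of $G$ into $k$ sets of the minimum of $u_a$ over those sets. *)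

theory Defs
  imports Complex_Main
begin

text \<open>Groups are indexed by 0..k-1; group i has agents 0..n i - 1.
  An allocation is a function P from group indices to bundles, i.e. a partition
  of G into k (possibly empty) sets.\<close>

definition is_allocation :: "nat \<Rightarrow> 'g set \<Rightarrow> (nat \<Rightarrow> 'g set) \<Rightarrow> bool" where
  "is_allocation k G P \<longleftrightarrow>
     (\<Union>i<k. P i) = G \<and> (\<forall>i<k. \<forall>i'<k. i \<noteq> i' \<longrightarrow> P i \<inter> P i' = {})"

definition binary_util :: "'g set \<Rightarrow> ('g \<Rightarrow> nat) \<Rightarrow> bool" where
  "binary_util G u \<longleftrightarrow> (\<forall>g\<in>G. u g \<in> {0, 1})"

definition val :: "('g \<Rightarrow> nat) \<Rightarrow> 'g set \<Rightarrow> nat" where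
  "val u S = (\<Sum>g\<in>S. u g)"

definition EF1 :: "nat \<Rightarrow> ('g \<Rightarrow> nat) \<Rightarrow> (nat \<Rightarrow> 'g set) \<Rightarrow> nat \<Rightarrow> bool" where
  "EF1 k u P i \<longleftrightarrow>
     (\<forall>i'<k. \<exists>C. C \<subseteq> P i' \<and> card C \<le> 1 \<and> val u (P i) \<ge> val u (P i' - C))"

definition PROPk1 :: "nat \<Rightarrow> 'g set \<Rightarrow> ('g \<Rightarrow> nat) \<Rightarrow> (nat \<Rightarrow> 'g set) \<Rightarrow> nat \<Rightarrow> bool" where
  "PROPk1 k G u P i \<longleftrightarrow>
     (\<exists>C. C \<subseteq> G - P i \<and> card C \<le> k - 1 \<and>
          real (val u (P i)) \<ge> real (val u (G - C)) / real k)"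

definition MMS :: "nat \<Rightarrow> 'g set \<Rightarrow> ('g \<Rightarrow> nat) \<Rightarrow> nat" where
  "MMS k G u = Max ((\<lambda>Q. Min ((\<lambda>i. val u (Q i)) ` {..<k})) ` {Q. is_allocation k G Q})"

definition MMS_fair :: "nat \<Rightarrow> 'g set \<Rightarrow> ('g \<Rightarrow> nat) \<Rightarrow> (nat \<Rightarrow> 'g set) \<Rightarrow> nat \<Rightarrow> bool" where
  "MMS_fair k G u P i \<longleftrightarrow> val u (P i) \<ge> MMS k G u"

end

theory Submission
  imports Defs "HOL-Analysis.Brouwer_Fixpoint"
begin

text \<open>
  Arrange the goods on a line and blow every good up to \<open>k\<close> unit cells, giving a cake of
  \<open>p = m * k\<close> cells. Cut the cake into \<open>k\<close> intervals and let a group prefer a nonempty interval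
  that at least a \<open>1/k\<close> fraction of its members consider best (pigeonhole). Triangulate the
  cube of cut vectors by Kuhn simplices and let group \<open>\<Sum>x mod k\<close> own the vertex \<open>x\<close>, so that
  every simplex has one vertex of each owner. Sperner's lemma yields a simplex in which the
  \<open>k\<close> groups, each at its own vertex, prefer \<open>k\<close> different intervals. The \<open>k - 1\<close> cuts of the
  simplex leave a free residue \<open>\<theta>\<close> modulo \<open>k\<close> that none of them crosses, so sending a good to the
  side of its \<open>\<theta>\<close>-th cell rounds all vertices to the same allocation. For one agent the values of
  two bundles then move apart by less than two goods, which is EF1, and for binary utilities
  EF1 implies the other two notions.
\<close>

section \<open>A colourful Sperner lemma for Kuhn simplices\<close>

definition kuhn_point :: "nat \<Rightarrow> nat \<Rightarrow> (nat \<Rightarrow> nat) \<Rightarrow> bool" where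
  "kuhn_point p n x \<longleftrightarrow> (\<forall>j. x j \<le> p) \<and> (\<forall>j\<ge>n. x j = p)"

text \<open>\<open>reduced\<close> returns the first coordinate below \<open>n\<close> with a
  nonzero label, or \<open>n\<close> if there is none. Marking coordinate \<open>L x\<close> makes
  it return \<open>L x\<close>: the further marks forced where \<open>x j = p\<close> never come
  earlier, by \<open>top\<close>.\<close>

lemma kuhn_fully_labelled:
  assumes p: "0 < p"
    and le: "\<And>x. kuhn_point p n x \<Longrightarrow> L x \<le> n"
    and zero: "\<And>x j. kuhn_point p n x \<Longrightarrow> j < n \<Longrightarrow> x j = 0 \<Longrightarrow> L x \<noteq> j"
    and top: "\<And>x j. kuhn_point p n x \<Longrightarrow> j < n \<Longrightarrow> x j = p \<Longrightarrow> L x \<le> j"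
  obtains s where "ksimplex p n s" "L ` s = {..n}"
proof -
  \<comment> \<open>\<open>kuhn_combinatorial\<close> asks for the boundary conditions at all points
    bounded by \<open>p\<close>, while \<open>L\<close> is controlled only at Kuhn points; hence the
    guard.\<close>
  define lab where "lab x j = (if x j = p \<or> kuhn_point p n x \<and> L x = j then 1 else 0 :: nat)" for x j
  have "odd (card {s. ksimplex p n s \<and> (reduced n \<circ> lab) ` s = {..n}})"
    by (rule kuhn_combinatorial[OF p]) (use p zero in \<open>auto simp: lab_def\<close>)
  then have "{s. ksimplex p n s \<and> (reduced n \<circ> lab) ` s = {..n}} \<noteq> {}"
    by (metis card.empty even_zero)
  then obtain s where s: "ksimplex p n s" "(reduced n \<circ> lab) ` s = {..n}"
    by auto
  obtain base upd where "kuhn_simplex p n base upd s"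
    using s(1) by (auto elim: ksimplex.cases)
  then interpret kuhn_simplex p n base upd s .
  have "reduced n (lab x) = L x" if "x \<in> s" for x
  proof (rule reduced_labelling_unique)
    have x: "kuhn_point p n x"
      using that s_le_p out_eq_p by (auto simp: kuhn_point_def)
    show "L x \<le> n" using le[OF x] .
    show "\<forall>i<L x. lab x i = 0"
    proof (intro allI impI)
      fix i assume "i < L x"
      then show "lab x i = 0" using le[OF x] top[OF x, of i] by (auto simp: lab_def)
    qed
    show "L x = n \<or> lab x (L x) \<noteq> 0"
      using x by (simp add: lab_def)
  qed
  then have "L ` s = {..n}"
    using s(2) by (auto simp: image_def)
  then show thesis using that s(1) by blast
qed

text \<open>Each vertex is labelled by the labelling of its owner. Along a Kuhn simplex the
  coordinate sum rises by one per step, so its \<open>Suc n\<close> vertices meet every residue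
  modulo \<open>Suc n\<close>, that is every owner, exactly once.\<close>

lemma colourful_kuhn:
  assumes p: "0 < p"
    and le: "\<And>x i. kuhn_point p n x \<Longrightarrow> i \<le> n \<Longrightarrow> L i x \<le> n"
    and zero: "\<And>x i j. kuhn_point p n x \<Longrightarrow> i \<le> n \<Longrightarrow> j < n \<Longrightarrow> x j = 0 \<Longrightarrow> L i x \<noteq> j"
    and top: "\<And>x i j. kuhn_point p n x \<Longrightarrow> i \<le> n \<Longrightarrow> j < n \<Longrightarrow> x j = p \<Longrightarrow> L i x \<le> j"
  obtains q v where "kuhn_point p n q" "\<And>i. i \<le> n \<Longrightarrow> kuhn_point p n (v i)"
    "\<And>i j. i \<le> n \<Longrightarrow> q j \<le> v i j \<and> v i j \<le> Suc (q j)"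
    "bij_betw (\<lambda>i. L i (v i)) {..n} {..n}"
proof -
  define owner where "owner x = (\<Sum>j<n. x j) mod Suc n" for x :: "nat \<Rightarrow> nat"
  have owner_le: "owner x \<le> n" for x
    by (simp add: owner_def less_Suc_eq_le[symmetric])
  obtain s where s: "ksimplex p n s" "(\<lambda>x. L (owner x) x) ` s = {..n}"
  proof (rule kuhn_fully_labelled[OF p, of n "\<lambda>x. L (owner x) x"])
    show "L (owner x) x \<le> n" if "kuhn_point p n x" for x
      by (rule le[OF that owner_le])
    show "L (owner x) x \<noteq> j" if "kuhn_point p n x" "j < n" "x j = 0" for x j
      by (rule zero[OF that(1) owner_le that(2,3)])
    show "L (owner x) x \<le> j" if "kuhn_point p n x" "j < n" "x j = p" for x j
      by (rule top[OF that(1) owner_le that(2,3)])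
  qed
  obtain base upd where "kuhn_simplex p n base upd s"
    using s(1) by (auto elim: ksimplex.cases)
  then interpret kuhn_simplex p n base upd s .
  have point: "kuhn_point p n x" if "x \<in> s" for x
    using that s_le_p out_eq_p by (auto simp: kuhn_point_def)
  have sum_enum: "(\<Sum>j<n. enum i j) = (\<Sum>j<n. base j) + i" if "i \<le> n" for i
    using that
  proof (induction i)
    case 0
    then show ?case by (simp add: enum_0)
  next
    case (Suc i)
    have u: "upd i \<in> {..<n}" using Suc upd_space by simp
    have "(\<Sum>j<n. enum (Suc i) j) = Suc (enum i (upd i)) + (\<Sum>j\<in>{..<n} - {upd i}. enum i j)"
      using Suc u by (simp add: enum_Suc sum.remove[OF _ u])
    also have "\<dots> = Suc (\<Sum>j<n. enum i j)"
      by (simp add: sum.remove[OF _ u, of "enum i"])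
    finally show ?case using Suc by simp
  qed
  have "inj_on owner s"
  proof (rule inj_onI)
    fix x y assume "x \<in> s" "y \<in> s" "owner x = owner y"
    then obtain i j where ij: "x = enum i" "y = enum j" "i \<le> n" "j \<le> n"
      by (auto simp: s_eq)
    then have "((\<Sum>j<n. base j) + i) mod Suc n = ((\<Sum>j<n. base j) + j) mod Suc n"
      using \<open>owner x = owner y\<close> by (simp add: owner_def sum_enum)
    then have "i mod Suc n = j mod Suc n"
      by (simp add: nat_mod_eq_iff add.assoc del: mult_Suc)
    then show "x = y" using ij by simp
  qed
  moreover have "card s = Suc n"
    using s(1) ksimplex_card by blast
  ultimately have "owner ` s = {..n}"
    using owner_le by (intro card_subset_eq) (auto simp: card_image)
  then have ex: "\<exists>x\<in>s. owner x = i" if "i \<le> n" for i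
    using that by (metis atMost_iff imageE)
  define v where "v i = (SOME x. x \<in> s \<and> owner x = i)" for i
  have v: "v i \<in> s" "owner (v i) = i" if "i \<le> n" for i
    using someI_ex[of "\<lambda>x. x \<in> s \<and> owner x = i"] ex[OF that] by (auto simp: v_def)
  have v_owner: "v (owner x) = x" if "x \<in> s" for x
    using v[OF owner_le] \<open>inj_on owner s\<close> that by (auto dest: inj_onD)
  have "(\<lambda>i. L i (v i)) ` {..n} = {..n}"
  proof (intro equalityI subsetI)
    fix l assume "l \<in> {..n}"
    then have "l \<in> (\<lambda>x. L (owner x) x) ` s"
      by (simp only: s(2))
    then obtain x where x: "x \<in> s" "l = L (owner x) x"
      by (rule imageE)
    then have "l = L (owner x) (v (owner x))"
      using v_owner by simp
    then show "l \<in> (\<lambda>i. L i (v i)) ` {..n}"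
      using owner_le[of x] by (intro image_eqI[of _ _ "owner x"]) auto
  qed (use le v point in auto)
  then have bij: "bij_betw (\<lambda>i. L i (v i)) {..n} {..n}"
    unfolding bij_betw_def by (simp add: eq_card_imp_inj_on)
  \<comment> \<open>The base vertex serves as \<open>q\<close>: every vertex exceeds it by 0 or 1 in
    each coordinate.\<close>
  show thesis
    by (rule that[OF _ _ _ bij]) (auto intro: point base_in_s v base_le le_Suc_base)
qed

section \<open>Cuts of a line\<close>

text \<open>Running maxima turn an arbitrary, possibly unsorted, grid point into ordered cuts.
  Interval \<open>j\<close> is empty if \<open>x j = 0\<close>, and all intervals after
  \<open>j\<close> are empty if \<open>x j = p\<close>; these are the boundary conditions of the
  Sperner lemma.\<close>

fun cutpoint :: "(nat \<Rightarrow> nat) \<Rightarrow> nat \<Rightarrow> nat" where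
  "cutpoint x 0 = 0"
| "cutpoint x (Suc j) = max (cutpoint x j) (x j)"

lemma cutpoint_mono: "i \<le> j \<Longrightarrow> cutpoint x i \<le> cutpoint x j"
  by (induction j) (auto simp: le_Suc_eq)

lemma cutpoint_le: "kuhn_point p n x \<Longrightarrow> cutpoint x j \<le> p"
  by (induction j) (auto simp: kuhn_point_def)

lemma cutpoint_last: "kuhn_point p n x \<Longrightarrow> cutpoint x (Suc n) = p"
  using cutpoint_le[of p n x n] by (simp add: kuhn_point_def)

lemma cutpoint_close:
  assumes "\<And>j. q j \<le> x j \<and> x j \<le> Suc (q j)"
  shows "cutpoint q j \<le> cutpoint x j \<and> cutpoint x j \<le> Suc (cutpoint q j)"
proof (induction j)
  case (Suc j)
  then show ?case using assms[of j] by auto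
qed auto

lemma between_consecutive:
  assumes "c 0 < t" "t \<le> c (n::nat)"
  shows "\<exists>j<n. c j < t \<and> t \<le> (c (Suc j) :: nat)"
  using assms(2)
proof (induction n)
  case 0
  then show ?case using assms(1) by simp
next
  case (Suc n)
  then show ?case by (metis less_Suc_eq not_le)
qed

text \<open>Pigeonhole: \<open>n\<close> numbers miss one of \<open>Suc n\<close> residues. Residue
  0 is represented by \<open>Suc n\<close>, so that \<theta> can number the cells of a good starting
  from 1.\<close>

lemma free_residue:
  fixes c :: "nat \<Rightarrow> nat"
  obtains \<theta> where "1 \<le> \<theta>" "\<theta> \<le> Suc n" "\<And>j. 1 \<le> j \<Longrightarrow> j \<le> n \<Longrightarrow> c j mod Suc n \<noteq> \<theta> mod Suc n"
proof -
  have "card ((\<lambda>j. c j mod Suc n) ` {1..n}) < card {..n}"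
    using card_image_le[of "{1..n}" "\<lambda>j. c j mod Suc n"] by simp
  then have "\<not> {..n} \<subseteq> (\<lambda>j. c j mod Suc n) ` {1..n}"
    using card_mono[of "(\<lambda>j. c j mod Suc n) ` {1..n}" "{..n}"] by fastforce
  then obtain r where r: "r \<le> n" "r \<notin> (\<lambda>j. c j mod Suc n) ` {1..n}" by auto
  show thesis
  proof (cases "r = 0")
    case True
    show thesis using r True by (intro that[of "Suc n"]) force+
  next
    case False
    show thesis using r False by (intro that[of r]) force+
  qed
qed

section \<open>Rounding\<close>

text \<open>Every cell of good \<open>t\<close> carries the full weight \<open>w t\<close>, so
  values are scaled by \<open>k\<close> and remain natural numbers.\<close>

definition cake :: "nat \<Rightarrow> (nat \<Rightarrow> nat) \<Rightarrow> nat \<Rightarrow> nat" where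
  "cake k w c = (\<Sum>y<c. w (y div k))"

text \<open>\<open>k * t + \<theta> \<le> c\<close> says that the \<theta>-th cell of good
  \<open>t\<close> lies among the first \<open>c\<close> cells.\<close>

definition rounded :: "nat \<Rightarrow> nat \<Rightarrow> (nat \<Rightarrow> nat) \<Rightarrow> nat \<Rightarrow> nat" where
  "rounded k \<theta> w c = (\<Sum>t | k * t + \<theta> \<le> c. w t)"

text \<open>Allowing \<open>r = k\<close> lets the end of good \<open>t\<close> start the induction
  for good \<open>Suc t\<close>.\<close>

lemma cake_decomp:
  "r \<le> k \<Longrightarrow> cake k w (k * t + r) = k * (\<Sum>s<t. w s) + r * w t"
proof (induction t arbitrary: r)
  case 0
  then show ?case
    by (induction r) (auto simp: cake_def)
next
  case (Suc t)
  have base: "cake k w (k * Suc t) = k * (\<Sum>s<Suc t. w s)"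
    using Suc.IH[of k] by (simp add: algebra_simps)
  show ?case using Suc.prems
  proof (induction r)
    case (Suc r)
    have "(k * Suc t + r) div k = Suc t"
      using Suc.prems by (intro div_nat_eqI) auto
    then show ?case using Suc by (simp add: cake_def)
  qed (use base in simp)
qed

lemma rounded_decomp:
  assumes "r < k" "1 \<le> \<theta>" "\<theta> \<le> k"
  shows "rounded k \<theta> w (k * t + r) = (\<Sum>s<t. w s) + (if \<theta> \<le> r then w t else 0)"
proof -
  have "{s. k * s + \<theta> \<le> k * t + r} = (if \<theta> \<le> r then {..<Suc t} else {..<t})" (is "?A = ?B")
  proof -
    have "k * s + \<theta> \<le> k * t + r \<longleftrightarrow> s < t \<or> s = t \<and> \<theta> \<le> r" for s
    proof (cases s t rule: linorder_cases)
      case less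
      then have "k * Suc s \<le> k * t" by (intro mult_le_mono2) simp
      then show ?thesis using less assms by simp
    next
      case greater
      then have "k * Suc t \<le> k * s" by (intro mult_le_mono2) simp
      then show ?thesis using greater assms by simp
    qed simp
    then show ?thesis by (cases "\<theta> \<le> r") (simp_all add: lessThan_def less_Suc_eq)
  qed
  then show ?thesis by (simp add: rounded_def)
qed

text \<open>\<open>k * rounded k \<theta> w c + \<theta> - cake k w c\<close> always lies between 1
  and \<open>k\<close>. Hence the rounding errors at any two cuts differ by at most
  \<open>k - 1\<close>.\<close>

lemma rounding_error:
  assumes w: "\<And>t. w t \<le> 1" and \<theta>: "1 \<le> \<theta>" "\<theta> \<le> k"
  shows "cake k w c < k * rounded k \<theta> w c + \<theta>"
    and "k * rounded k \<theta> w c + \<theta> \<le> cake k w c + k"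
proof -
  define t r where "t = c div k" and "r = c mod k"
  have c: "c = k * t + r" and r: "r < k"
    using \<theta> by (auto simp: t_def r_def)
  have "w t = 0 \<or> w t = 1" using w[of t] by auto
  then show "cake k w c < k * rounded k \<theta> w c + \<theta>" "k * rounded k \<theta> w c + \<theta> \<le> cake k w c + k"
    using r \<theta> unfolding c
    by (auto simp: cake_decomp rounded_decomp distrib_left)
qed

text \<open>The own interval runs from \<open>a\<close> to \<open>b\<close>, the other from
  \<open>a'\<close> to \<open>b'\<close>; sums replace differences to stay in \<open>nat\<close>.
  Scaled by \<open>k\<close>, rounding adds at most \<open>2 * (k - 1)\<close> to the envy, whereas
  envy 2 would need \<open>2 * k\<close>.\<close>

lemma rounded_envy_le_1:
  assumes w: "\<And>t. w t \<le> 1" and \<theta>: "1 \<le> \<theta>" "\<theta> \<le> k"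
    and ef: "cake k w b' + cake k w a \<le> cake k w b + cake k w a'"
  shows "rounded k \<theta> w b' + rounded k \<theta> w a \<le> rounded k \<theta> w b + rounded k \<theta> w a' + 1"
proof (rule ccontr)
  let ?R = "rounded k \<theta> w"
  assume "\<not> ?thesis"
  then have "?R b + ?R a' + 2 \<le> ?R b' + ?R a" by simp
  then have "k * (?R b + ?R a' + 2) \<le> k * (?R b' + ?R a)" by (rule mult_le_mono2)
  then have "k * ?R b + k * ?R a' + 2 * k \<le> k * ?R b' + k * ?R a"
    by (simp add: algebra_simps)
  then show False
    using rounding_error[of w \<theta> k b, OF w \<theta>] rounding_error[of w \<theta> k a, OF w \<theta>]
      rounding_error[of w \<theta> k b', OF w \<theta>] rounding_error[of w \<theta> k a', OF w \<theta>] ef by linarith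
qed

section \<open>Binary utilities\<close>

lemma val_union:
  assumes "is_allocation k G P" "finite G"
  shows "val u G = (\<Sum>i<k. val u (P i))"
proof -
  have "finite (P i)" if "i < k" for i
    using assms that by (auto simp: is_allocation_def intro: finite_subset)
  then have "(\<Sum>i<k. val u (P i)) = val u (\<Union>i<k. P i)"
    unfolding val_def using assms
    by (intro sum.UNION_disjoint[symmetric]) (auto simp: is_allocation_def)
  then show ?thesis using assms by (simp add: is_allocation_def)
qed

text \<open>A binary value counts the goods of utility 1, so \<open>C\<close> consists of
  \<open>m\<close> of these, or of all if there are fewer. The subtraction is truncated.\<close>

lemma remove_ones:
  assumes "finite S" "binary_util S u"
  shows "\<exists>C\<subseteq>S. card C \<le> m \<and> val u (S - C) \<le> val u S - m"
proof -
  define T where "T = {g \<in> S. u g = 1}"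
  have T: "T \<subseteq> S" "finite T" using assms by (auto simp: T_def)
  have val: "val u (S - C) = card (T - C)" for C
  proof -
    have "val u (S - C) = (\<Sum>g\<in>S - C. if g \<in> T then 1 else 0)"
      unfolding val_def using assms by (intro sum.cong) (auto simp: T_def binary_util_def)
    also have "\<dots> = card ((S - C) \<inter> T)" using assms by (simp add: sum.If_cases)
    also have "(S - C) \<inter> T = T - C" using T by auto
    finally show ?thesis .
  qed
  obtain C where C: "C \<subseteq> T" "card C = min m (card T)"
    using T by (meson min.cobounded2 obtain_subset_with_card_n)
  then have "card (T - C) \<le> card T - m"
    using T by (subst card_Diff_subset) (auto intro: finite_subset)
  then show ?thesis
    using C T val[of C] val[of "{}"] by (intro exI[of _ C]) auto
qed

lemma val_total_le:
  assumes "is_allocation k G P" "finite G" "i < k"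
    and "\<And>j. j < k \<Longrightarrow> val u (P j) \<le> val u (P i) + 1"
  shows "val u G \<le> k * val u (P i) + (k - 1)"
proof -
  have "val u G = val u (P i) + (\<Sum>j\<in>{..<k} - {i}. val u (P j))"
    using val_union[OF assms(1,2)] assms(3) by (simp add: sum.remove[of _ i])
  also have "(\<Sum>j\<in>{..<k} - {i}. val u (P j)) \<le> (\<Sum>j\<in>{..<k} - {i}. val u (P i) + 1)"
    using assms(4) by (intro sum_mono) auto
  also have "\<dots> = (k - 1) * (val u (P i) + 1)"
    using assms(3) by simp
  also have "val u (P i) + (k - 1) * (val u (P i) + 1) = k * val u (P i) + (k - 1)"
    using assms(3) by (cases k) (auto simp: algebra_simps)
  finally show ?thesis by simp
qed

lemma MMS_mult_le:
  assumes "finite G" "0 < k"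
  shows "k * MMS k G u \<le> val u G"
proof -
  let ?f = "\<lambda>Q. Min ((\<lambda>i. val u (Q i)) ` {..<k})"
  have bound: "k * ?f Q \<le> val u G" if Q: "is_allocation k G Q" for Q
  proof -
    have "k * ?f Q = (\<Sum>i<k. ?f Q)" by simp
    also have "\<dots> \<le> (\<Sum>i<k. val u (Q i))" by (intro sum_mono Min_le) auto
    finally show ?thesis using val_union[OF Q assms(1)] by simp
  qed
  \<comment> \<open>There are infinitely many \<open>Q\<close>, being unconstrained from index
    \<open>k\<close> on, so finiteness for \<open>Max\<close> comes from the bounded range of
    values.\<close>
  have "?f ` {Q. is_allocation k G Q} \<subseteq> {..val u G}"
  proof clarsimp
    fix Q assume "is_allocation k G Q"
    then have "k * ?f Q \<le> val u G" by (rule bound)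
    moreover have "?f Q \<le> k * ?f Q" using assms(2) by simp
    ultimately show "?f Q \<le> val u G" by linarith
  qed
  then have fin: "finite (?f ` {Q. is_allocation k G Q})"
    by (rule finite_subset) simp
  have "is_allocation k G (\<lambda>i. if i = 0 then G else {})"
    using assms(2) by (auto simp: is_allocation_def)
  then have "MMS k G u \<in> ?f ` {Q. is_allocation k G Q}"
    unfolding MMS_def by (intro Max_in[OF fin]) auto
  then show ?thesis using bound by auto
qed

text \<open>For EF1 drop one valued good. By \<open>total\<close>, \<open>val u G\<close> is at most
  \<open>k * val u (P i) + (k - 1)\<close>: dropping up to \<open>k - 1\<close> valued goods outside
  \<open>P i\<close> gives PROP, and averaging over an MMS partition gives MMS-fairness.\<close>

lemma fair_if_envy_le_1:
  assumes P: "is_allocation k G P" and G: "finite G" and u: "binary_util G u" and i: "i < k"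
    and envy: "\<And>j. j < k \<Longrightarrow> val u (P j) \<le> val u (P i) + 1"
  shows "EF1 k u P i \<and> PROPk1 k G u P i \<and> MMS_fair k G u P i"
proof (intro conjI)
  have sub: "P j \<subseteq> G" if "j < k" for j
    using P that by (auto simp: is_allocation_def)
  note total = val_total_le[OF P G i envy]
  show "EF1 k u P i"
    unfolding EF1_def
  proof (intro allI impI)
    fix j assume j: "j < k"
    have "finite (P j)" "binary_util (P j) u"
      using sub[OF j] G u by (auto simp: binary_util_def intro: finite_subset)
    from remove_ones[OF this, of 1] obtain C where
      C: "C \<subseteq> P j" "card C \<le> 1" "val u (P j - C) \<le> val u (P j) - 1"
      by blast
    then have "val u (P j - C) \<le> val u (P i)" using envy[OF j] by linarith
    then show "\<exists>C\<subseteq>P j. card C \<le> 1 \<and> val u (P j - C) \<le> val u (P i)"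
      using C by blast
  qed
  have "finite (G - P i)" "binary_util (G - P i) u"
    using G u by (auto simp: binary_util_def)
  from remove_ones[OF this, of "k - 1"] obtain C where
    C: "C \<subseteq> G - P i" "card C \<le> k - 1" "val u (G - P i - C) \<le> val u (G - P i) - (k - 1)"
    by blast
  have fin: "finite (P i)" using sub[OF i] G finite_subset by blast
  have split: "val u (G - D) = val u (P i) + val u (G - P i - D)" if "D \<subseteq> G - P i" for D
  proof -
    have "G - D = P i \<union> (G - P i - D)" using that sub[OF i] by auto
    moreover have "sum u (P i \<union> (G - P i - D)) = sum u (P i) + sum u (G - P i - D)"
      using G fin by (intro sum.union_disjoint) auto
    ultimately show ?thesis by (simp add: val_def)
  qed
  have "val u (G - C) \<le> k * val u (P i)"
  \<comment> \<open>If the subtraction truncates, nothing of value is left outside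
    \<open>P i\<close>; otherwise it is exact and \<open>total\<close> applies.\<close>
  proof (cases "val u (G - P i) \<le> k - 1")
    case True
    then show ?thesis using split[OF C(1)] C(3) i by simp
  next
    case False
    then show ?thesis using split[OF C(1)] split[of "{}"] C(3) total by simp
  qed
  then have "real (val u (G - C)) \<le> real k * real (val u (P i))"
    by (metis of_nat_le_iff of_nat_mult)
  then have "real (val u (G - C)) / real k \<le> real (val u (P i))"
    using i by (simp add: divide_le_eq mult.commute)
  then show "PROPk1 k G u P i"
    unfolding PROPk1_def using C by blast
  have "k * MMS k G u < k * (val u (P i) + 1)"
    using MMS_mult_le[OF G, of k u] total i by (simp add: algebra_simps)
  then show "MMS_fair k G u P i"
    unfolding MMS_fair_def by (metis less_Suc_eq_le Suc_eq_plus1 mult_less_cancel1)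
qed

section \<open>The allocation\<close>

text \<open>Pigeonhole, with ties allowed. The chosen \<open>j\<close> has a supporter, who
  certifies that the chosen interval is nonempty.\<close>

lemma plurality_choice:
  assumes B: "\<And>a. a < n \<Longrightarrow> \<exists>j<k. B a j" and n: "0 < n"
  shows "\<exists>j<k. (\<exists>a<n. B a j) \<and> n \<le> k * card {a. a < n \<and> B a j}"
proof -
  have "0 < k" using B[OF n] by auto
  have "\<exists>j<k. n \<le> k * card {a. a < n \<and> B a j}"
  proof (rule ccontr)
    assume "\<not> ?thesis"
    then have less: "k * card {a. a < n \<and> B a j} < n" if "j < k" for j
      using that by (meson not_le)
    have "{..<n} \<subseteq> (\<Union>j<k. {a. a < n \<and> B a j})"
      using B by auto
    then have "n \<le> card (\<Union>j<k. {a. a < n \<and> B a j})"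
      using card_mono[of "\<Union>j<k. {a. a < n \<and> B a j}" "{..<n}"] by simp
    also have "\<dots> \<le> (\<Sum>j<k. card {a. a < n \<and> B a j})"
      by (rule card_UN_le) simp
    finally have "k * n \<le> (\<Sum>j<k. k * card {a. a < n \<and> B a j})"
      by (simp add: sum_distrib_left[symmetric])
    also have "\<dots> < (\<Sum>j<k. n)"
      using less \<open>0 < k\<close> by (intro sum_strict_mono) auto
    finally show False by simp
  qed
  then obtain j where j: "j < k" "n \<le> k * card {a. a < n \<and> B a j}" by blast
  then have "card {a. a < n \<and> B a j} \<noteq> 0"
    using n by (intro notI) simp
  then have "{a. a < n \<and> B a j} \<noteq> {}"
    by (metis card.empty)
  then show ?thesis using j by blast
qed

text \<open>Maximise over the pieces with \<open>E\<close> only; the others have value 0 and cannot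
  beat them. So even an agent who values nothing has a nonempty favourite.\<close>

lemma exists_best_piece:
  fixes k :: nat
  assumes f: "\<And>j. j < k \<Longrightarrow> \<not> E j \<Longrightarrow> f j = (0 :: int)" "\<And>j. j < k \<Longrightarrow> 0 \<le> f j"
    and ex: "\<exists>j<k. E j"
  shows "\<exists>j<k. E j \<and> (\<forall>l<k. f l \<le> f j)"
proof -
  let ?J = "{j. j < k \<and> E j}"
  have fin: "finite (f ` ?J)"
    by (intro finite_imageI finite_subset[of ?J "{..<k}"]) auto
  moreover have "f ` ?J \<noteq> {}" using ex by auto
  ultimately have "Max (f ` ?J) \<in> f ` ?J" by (rule Max_in)
  then obtain j where j: "j \<in> ?J" "Max (f ` ?J) = f j" by blast
  then have "f l \<le> f j" if "l \<in> ?J" for l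
    using Max_ge[OF fin] that by (metis imageI)
  then have j: "j \<in> ?J" "\<forall>l\<in>?J. f l \<le> f j" using j by blast+
  have "f l \<le> f j" if "l < k" for l
    using that j f by (cases "E l") auto
  then show ?thesis using j by blast
qed

lemma cake_mono: "a \<le> b \<Longrightarrow> cake k w a \<le> cake k w b"
  unfolding cake_def by (rule sum_mono2) auto

lemma exists_best_interval:
  assumes "kuhn_point p n x" "0 < p"
  shows "\<exists>j<Suc n. cutpoint x j < cutpoint x (Suc j) \<and> (\<forall>l<Suc n.
    cake k w (cutpoint x (Suc l)) + cake k w (cutpoint x j) \<le> cake k w (cutpoint x (Suc j)) + cake k w (cutpoint x l))"
proof -
  let ?f = "\<lambda>j. int (cake k w (cutpoint x (Suc j))) - int (cake k w (cutpoint x j))"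
  have "\<exists>j<Suc n. cutpoint x j < cutpoint x (Suc j)"
    using between_consecutive[of "cutpoint x" p "Suc n"] cutpoint_last[OF assms(1)] assms(2)
    by (metis cutpoint.simps(1) le_refl less_le_trans)
  moreover have "?f j = 0" if "\<not> cutpoint x j < cutpoint x (Suc j)" for j
    using that cutpoint_mono[of j "Suc j" x] by simp
  moreover have "0 \<le> ?f j" for j
    using cake_mono[OF cutpoint_mono[of j "Suc j" x], of k w] by simp
  ultimately obtain j where "j < Suc n" "cutpoint x j < cutpoint x (Suc j)" "\<forall>l<Suc n. ?f l \<le> ?f j"
    using exists_best_piece[of "Suc n" "\<lambda>j. cutpoint x j < cutpoint x (Suc j)" ?f] by blast
  then show ?thesis
    by (intro exI[of _ j]) (auto simp del: cutpoint.simps simp: algebra_simps)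
qed

text \<open>Advancing a cut by one cell changes the rounded value only if the new position is some
  \<open>k * t + \<theta>\<close>.\<close>

lemma rounded_eq_if_not_crossed:
  assumes "c \<le> c'" "c' \<le> Suc c" "c' = c \<or> Suc c mod k \<noteq> \<theta> mod k"
  shows "rounded k \<theta> w c' = rounded k \<theta> w c"
proof -
  have "k * t + \<theta> \<noteq> c'" if "c' \<noteq> c" for t
    using that assms by (metis le_SucE le_antisym mod_mult_self4)
  then have "k * t + \<theta> \<le> c' \<longleftrightarrow> k * t + \<theta> \<le> c" for t
    using assms by (metis le_SucE le_antisym le_trans)
  then show ?thesis by (simp add: rounded_def)
qed

text \<open>This turns differences of rounded prefix values into values of actual bundles;
  \<open>b \<le> k * m\<close> keeps all indices below \<open>m\<close>.\<close>

lemma rounded_split: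
  assumes g: "inj_on g {..<m}" and b: "a \<le> b" "b \<le> k * m" and \<theta>: "1 \<le> \<theta>" and k: "0 < k"
    and w: "\<And>t. t < m \<Longrightarrow> w t = u (g t)"
  shows "rounded k \<theta> w b =
    rounded k \<theta> w a + val u (g ` {t. a < k * t + \<theta> \<and> k * t + \<theta> \<le> b})"
proof -
  let ?B = "{t. a < k * t + \<theta> \<and> k * t + \<theta> \<le> b}"
  have lt: "t < m" if "k * t + \<theta> \<le> b" for t
  proof -
    have "k * t < k * m" using that b \<theta> by linarith
    then show ?thesis by simp
  qed
  have fin: "finite {t. k * t + \<theta> \<le> b}"
    by (rule finite_subset[of _ "{..<m}"]) (use lt in auto)
  have "val u (g ` ?B) = (\<Sum>t\<in>?B. u (g t))"
    unfolding val_def using lt by (subst sum.reindex) (auto intro: inj_on_subset[OF g])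
  also have "\<dots> = (\<Sum>t\<in>?B. w t)"
    by (rule sum.cong) (auto simp: w lt)
  finally have "rounded k \<theta> w a + val u (g ` ?B) = (\<Sum>t\<in>{t. k * t + \<theta> \<le> a} \<union> ?B. w t)"
    unfolding rounded_def using b
    by (subst sum.union_disjoint) (auto intro: finite_subset[OF _ fin])
  also have "{t. k * t + \<theta> \<le> a} \<union> ?B = {t. k * t + \<theta> \<le> b}"
    using b by auto
  finally show ?thesis by (simp add: rounded_def)
qed

text \<open>As \<theta> is between 1 and \<open>k\<close>, each good has a \<theta>-th cell, which
  lies in exactly one interval; \<sigma> only permutes the intervals among the groups.\<close>

lemma interval_allocation:
  assumes g: "bij_betw g {..<m} G" and q: "kuhn_point (k * m) n q" and k: "k = Suc n"
    and \<theta>: "1 \<le> \<theta>" "\<theta> \<le> k" and \<sigma>: "bij_betw \<sigma> {..n} {..n}"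
  shows "is_allocation k G
    (\<lambda>i. g ` {t. cutpoint q (\<sigma> i) < k * t + \<theta> \<and> k * t + \<theta> \<le> cutpoint q (Suc (\<sigma> i))})"
    (is "is_allocation k G (\<lambda>i. g ` ?T i)")
proof -
  have lt: "t < m" if "k * t + \<theta> \<le> cutpoint q j" for t j
  proof -
    have "k * t < k * m" using that cutpoint_le[OF q, of j] \<theta> by linarith
    then show ?thesis by simp
  qed
  have "(\<Union>i<k. g ` ?T i) = G"
  proof (intro equalityI subsetI)
    fix y assume "y \<in> (\<Union>i<k. g ` ?T i)"
    then show "y \<in> G" using lt g by (auto simp: bij_betw_def simp del: cutpoint.simps)
  next
    fix y assume "y \<in> G"
    then obtain t where t: "t < m" "y = g t" using g by (auto simp: bij_betw_def)
    have "k * Suc t \<le> k * m" using t by (intro mult_le_mono2) simp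
    then have "k * t + \<theta> \<le> cutpoint q (Suc n)" using cutpoint_last[OF q] \<theta> by simp
    then obtain j where j: "j < Suc n" "cutpoint q j < k * t + \<theta>" "k * t + \<theta> \<le> cutpoint q (Suc j)"
      using between_consecutive[of "cutpoint q" "k * t + \<theta>" "Suc n"] \<theta> by auto
    then obtain i where "i \<le> n" "\<sigma> i = j"
      using \<sigma> by (metis atMost_iff bij_betw_iff_bijections less_Suc_eq_le)
    then show "y \<in> (\<Union>i<k. g ` ?T i)"
      using j t k by (auto simp del: cutpoint.simps intro!: bexI[of _ i])
  qed
  moreover have "g ` ?T i \<inter> g ` ?T i' = {}" if i: "i < k" "i' < k" "i \<noteq> i'" for i i'
  proof -
    have ne: "\<sigma> i \<noteq> \<sigma> i'"
      using \<sigma> i k by (auto simp: bij_betw_def inj_on_def)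
    have "?T i \<inter> ?T i' = {}"
    proof (cases "\<sigma> i < \<sigma> i'")
      case True
      then show ?thesis using cutpoint_mono[of "Suc (\<sigma> i)" "\<sigma> i'" q] by (auto simp del: cutpoint.simps)
    next
      case False
      then show ?thesis using ne cutpoint_mono[of "Suc (\<sigma> i')" "\<sigma> i" q] by (auto simp del: cutpoint.simps)
    qed
    moreover have "?T i \<subseteq> {..<m}" "?T i' \<subseteq> {..<m}" using lt by (auto simp del: cutpoint.simps)
    ultimately show ?thesis
      using inj_on_image_Int[OF bij_betw_imp_inj_on[OF g], of "?T i" "?T i'"] by simp
  qed
  ultimately show ?thesis unfolding is_allocation_def by blast
qed

theorem mainTheorem17:
  fixes k :: nat and G :: "'g set" and n :: "nat \<Rightarrow> nat"
    and u :: "nat \<Rightarrow> nat \<Rightarrow> 'g \<Rightarrow> nat"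
  assumes "k \<ge> 2" and "finite G"
    and "\<forall>i<k. n i \<ge> 1"
    and "\<forall>i<k. \<forall>a<n i. binary_util G (u i a)"
  shows "\<exists>P. is_allocation k G P \<and>
           (\<forall>i<k. real (card {a. a < n i \<and> EF1 k (u i a) P i \<and> PROPk1 k G (u i a) P i
                                   \<and> MMS_fair k G (u i a) P i})
                  \<ge> real (n i) / real k)"
proof -
  have "\<exists>P. is_allocation k G P \<and> (\<forall>i<k. n i \<le> k * card {a. a < n i \<and>
    (\<forall>j<k. val (u i a) (P j) \<le> val (u i a) (P i) + 1)})"
  \<comment> \<open>Without goods the cake has no cells, and the Sperner lemma needs
    \<open>0 < p\<close>.\<close>
  proof (cases "G = {}")
    case True
    then show ?thesis
      using assms(1) by (intro exI[of _ "\<lambda>_. {}"]) (auto simp: is_allocation_def val_def)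
  next
    case False
    define m where "m = card G"
    obtain g where g: "bij_betw g {..<m} G"
      using ex_bij_betw_nat_finite[OF assms(2)] by (auto simp: m_def atLeast0LessThan)
    have m: "0 < m" using False assms(2) by (simp add: m_def card_gt_0_iff)
    obtain N where k: "k = Suc N" using assms(1) by (cases k) auto
    have p: "0 < k * m" using m k by simp
    \<comment> \<open>The default 0 beyond \<open>m\<close> keeps all weights at most 1, as the
      rounding lemmas demand for every index.\<close>
    define w where "w i a t = (if t < m then u i a (g t) else 0)" for i a t
    have w: "w i a t \<le> 1" if "i < k" "a < n i" for i a t
    proof (cases "t < m")
      case True
      then have "g t \<in> G" using bij_betwE[OF g] by blast
      then have "u i a (g t) \<in> {0, 1}" using assms(4) that unfolding binary_util_def by blast
      then show ?thesis by (auto simp: w_def)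
    qed (simp add: w_def)
    define F where "F i a c = cake k (w i a) c" for i a c
    define best where "best i x a j \<longleftrightarrow> cutpoint x j < cutpoint x (Suc j) \<and> (\<forall>l<k.
      F i a (cutpoint x (Suc l)) + F i a (cutpoint x j) \<le> F i a (cutpoint x (Suc j)) + F i a (cutpoint x l))" for i x a j
    define pref where "pref i x = (SOME j. j < k \<and> (\<exists>a<n i. best i x a j) \<and>
      n i \<le> k * card {a. a < n i \<and> best i x a j})" for i x
    have pref: "pref i x \<le> N \<and> cutpoint x (pref i x) < cutpoint x (Suc (pref i x)) \<and>
        n i \<le> k * card {a. a < n i \<and> best i x a (pref i x)}"
      if x: "kuhn_point (k * m) N x" and i: "i \<le> N" for i x
    proof -
      have "\<exists>j<k. best i x a j" for a
        unfolding best_def F_def k using exists_best_interval[OF x p] by (simp add: k)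
      then have "\<exists>j<k. (\<exists>a<n i. best i x a j) \<and> n i \<le> k * card {a. a < n i \<and> best i x a j}"
        using assms(3) i k by (intro plurality_choice) (auto simp: Suc_le_eq less_Suc_eq_le)
      from someI_ex[OF this] have "pref i x < k" "\<exists>a<n i. best i x a (pref i x)"
        "n i \<le> k * card {a. a < n i \<and> best i x a (pref i x)}"
        by (simp_all add: pref_def)
      then show ?thesis by (auto simp: k best_def simp del: cutpoint.simps)
    qed
    have zero: "pref i x \<noteq> j" if "kuhn_point (k * m) N x" "i \<le> N" "x j = 0" for i x j
      using pref[OF that(1,2)] that(3) by auto
    have top: "pref i x \<le> j" if "kuhn_point (k * m) N x" "i \<le> N" "x j = k * m" for i x j
    proof (rule ccontr)
      assume "\<not> pref i x \<le> j"
      then have "cutpoint x (Suc j) \<le> cutpoint x (pref i x)" by (intro cutpoint_mono) simp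
      then show False
        using pref[OF that(1,2)] that(3) cutpoint_le[OF that(1), of "Suc (pref i x)"] by simp
    qed
    obtain q v where q: "kuhn_point (k * m) N q"
      and v: "\<And>i. i \<le> N \<Longrightarrow> kuhn_point (k * m) N (v i)"
      and close: "\<And>i j. i \<le> N \<Longrightarrow> q j \<le> v i j \<and> v i j \<le> Suc (q j)"
      and bij: "bij_betw (\<lambda>i. pref i (v i)) {..N} {..N}"
      using colourful_kuhn[OF p, of N pref] pref zero top by blast
    define \<sigma> where "\<sigma> i = pref i (v i)" for i
    have \<sigma>: "bij_betw \<sigma> {..N} {..N}" using bij by (simp add: \<sigma>_def[abs_def])
    \<comment> \<open>Cuts at a vertex exceed those at \<open>q\<close> by at most one, so the
      \<open>j\<close>-th cut can only pass to \<open>Suc (cutpoint q j)\<close>. Only the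
      \<open>N\<close> inner cuts matter: both ends of the cake are fixed.\<close>
    obtain \<theta> where \<theta>: "1 \<le> \<theta>" "\<theta> \<le> k"
      and free: "\<And>j. 1 \<le> j \<Longrightarrow> j \<le> N \<Longrightarrow> Suc (cutpoint q j) mod k \<noteq> \<theta> mod k"
      using free_residue[of N "\<lambda>j. Suc (cutpoint q j)"] k by metis
    define P where "P i = g ` {t. cutpoint q (\<sigma> i) < k * t + \<theta> \<and> k * t + \<theta> \<le> cutpoint q (Suc (\<sigma> i))}" for i
    have alloc: "is_allocation k G P"
      unfolding P_def[abs_def] by (rule interval_allocation[OF g q k \<theta> \<sigma>])
    have same: "rounded k \<theta> z (cutpoint (v i) j) = rounded k \<theta> z (cutpoint q j)" if "i \<le> N" "j \<le> k" for i j z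
    proof (rule rounded_eq_if_not_crossed)
      show "cutpoint (v i) j = cutpoint q j \<or> Suc (cutpoint q j) mod k \<noteq> \<theta> mod k"
        using free[of j] cutpoint_last[OF q] cutpoint_last[OF v[OF that(1)]] that(2) k
        by (cases "j = 0"; cases "j = k") (auto simp del: cutpoint.simps(2))
    qed (use cutpoint_close close[OF that(1)] in blast)+
    \<comment> \<open>Group \<open>i\<close> compares intervals at its own vertex
      \<open>v i\<close>; by \<open>same\<close> the rounded values there equal those at
      \<open>q\<close>, which defines \<open>P\<close>.\<close>
    have envy: "val (u i a) (P j) \<le> val (u i a) (P i) + 1"
      if i: "i < k" and j: "j < k" and a: "a < n i" and best: "best i (v i) a (\<sigma> i)" for i j a
    proof -
      let ?R = "\<lambda>l. rounded k \<theta> (w i a) (cutpoint q l)"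
      have le: "\<sigma> i < k" "\<sigma> j < k" "i \<le> N"
        using bij_betwE[OF \<sigma>] i j k by (auto simp: less_Suc_eq_le)
      have "?R (Suc (\<sigma> j)) + ?R (\<sigma> i) \<le> ?R (Suc (\<sigma> i)) + ?R (\<sigma> j) + 1"
        using rounded_envy_le_1[of "w i a", OF w[OF i a] \<theta>, of "cutpoint (v i) (Suc (\<sigma> j))"
            "cutpoint (v i) (\<sigma> i)" "cutpoint (v i) (Suc (\<sigma> i))" "cutpoint (v i) (\<sigma> j)"] best le
        by (simp add: best_def F_def same del: cutpoint.simps)
      moreover have "?R (Suc (\<sigma> l)) = ?R (\<sigma> l) + val (u i a) (P l)" for l
        unfolding P_def
        using bij_betw_imp_inj_on[OF g] \<theta>(1) cutpoint_le[OF q] cutpoint_mono[of "\<sigma> l" "Suc (\<sigma> l)" q] i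
        by (intro rounded_split[where m = m]) (auto simp: w_def simp del: cutpoint.simps)
      ultimately show ?thesis by simp
    qed
    have "n i \<le> k * card {a. a < n i \<and> (\<forall>j<k. val (u i a) (P j) \<le> val (u i a) (P i) + 1)}"
      if i: "i < k" for i
    proof -
      have "n i \<le> k * card {a. a < n i \<and> best i (v i) a (\<sigma> i)}"
        using pref[OF v, of i i] i k by (simp add: \<sigma>_def)
      also have "\<dots> \<le> k * card {a. a < n i \<and> (\<forall>j<k. val (u i a) (P j) \<le> val (u i a) (P i) + 1)}"
        using envy[OF i] by (intro mult_le_mono2 card_mono) auto
      finally show ?thesis .
    qed
    then show ?thesis using alloc by blast
  qed
  then obtain P where P: "is_allocation k G P"
    and many: "\<And>i. i < k \<Longrightarrow> n i \<le> k * card {a. a < n i \<and>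
      (\<forall>j<k. val (u i a) (P j) \<le> val (u i a) (P i) + 1)}"
    by blast
  have "real (n i) / real k \<le> real (card {a. a < n i \<and> EF1 k (u i a) P i \<and>
      PROPk1 k G (u i a) P i \<and> MMS_fair k G (u i a) P i})" (is "_ \<le> real (card ?A)")
    if i: "i < k" for i
  proof -
    have "n i \<le> k * card {a. a < n i \<and> (\<forall>j<k. val (u i a) (P j) \<le> val (u i a) (P i) + 1)}"
      using many[OF i] .
    also have "\<dots> \<le> k * card ?A"
      using fair_if_envy_le_1[OF P assms(2) _ i] assms(4) i
      by (intro mult_le_mono2 card_mono) auto
    finally have "real (n i) \<le> real (k * card ?A)"
      by (simp only: of_nat_le_iff)
    then show ?thesis
      using i by (simp add: divide_le_eq mult.commute)
  qed
  then show ?thesis using P by blast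
qed

end
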